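(* Let $N,M$ be non-negative integers, let $f,g\in\mathbb{C}[x_1,\ldots,x_N,z_1^{\pm1},\ldots,z_M^{\pm1}]$, and let $\delta\in\mathbb{C}[x_1,\ldots,x_N]$ be a monomial of odd degree in all variables. If $\mathbf{0}$ is not in the convex hull of $\mathrm{Sp}(f)$ in $\mathbb{R}^M$, then $\int_{(N,M)}f^n g\,\delta=0$ for all but finitely many $n\in\mathbb{N}$.
   Context: $\mathbb{N}=\{1,2,\ldots\}$, $\mathbb{T}=\{z\in\mathbb{C}:|z|=1\}$. For $h\in\mathbb{C}[x_1,\ldots,x_N,z_1^{\pm1},\ldots,z_M^{\pm1}]$, $$\int_{(N,M)}h\,\delta:=\int_{[0,1]^N\times\mathbb{T}^M}h(x,z)\,\delta(x)\,dx_1\cdots dx_N\,\frac{dz_1}{z_1}\cdots\frac{dz_M}{z_M},$$ where each $\int_{\mathbb T}\cdots\frac{dz}{z}$ is a contour integral over the positively oriented unit circle. Write $f=\sum_{\mathbf m\in\mathbb{Z}^M}c_{\mathbf m}z^{\mathbf m}$ with $c_{\mathbf m}\in\mathbb{C}[x_1,\ldots,x_N]$ and $z^{\mathbf m}=\prod_i z_i^{m_i}$. The spectrum of $f$ is $\mathrm{Sp}(f)=\{\mathbf m\in\mathbb{Z}^M : c_{\mathbf m}\neq0\}$. *)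

theory Defs
  imports "HOL-Complex_Analysis.Contour_Integration" "HOL-Analysis.Finite_Function_Topology"
begin

text \<open>
  Polynomials over the complex numbers in variables \<open>x\<^sub>0, x\<^sub>1, \<dots>\<close> are finitely supported maps from
  exponent vectors to coefficients.  Laurent polynomials in \<open>z\<^sub>0, z\<^sub>1, \<dots>\<close> with such coefficients map
  \<open>m\<close> to the coefficient \<open>c\<^sub>m\<close> of \<open>z\<^sup>m\<close>.  Ring operations are the convolution instances of
  \<^theory>\<open>HOL-Library.Poly_Mapping\<close>.  The sets \<open>xpolys N\<close> and \<open>laurent N M\<close> below are the subrings
  of elements involving only \<open>x\<^sub>0, \<dots>, x\<^bsub>N-1\<^esub>\<close> and \<open>z\<^sub>0, \<dots>, z\<^bsub>M-1\<^esub>\<close>.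
\<close>

type_synonym xpoly = "(nat \<Rightarrow>\<^sub>0 nat) \<Rightarrow>\<^sub>0 complex"
type_synonym laurent_poly = "(nat \<Rightarrow>\<^sub>0 int) \<Rightarrow>\<^sub>0 xpoly"

definition xpolys :: "nat \<Rightarrow> xpoly set" where
  "xpolys N = {p. \<forall>a\<in>Poly_Mapping.keys p. Poly_Mapping.keys a \<subseteq> {..<N}}"

definition laurent :: "nat \<Rightarrow> nat \<Rightarrow> laurent_poly set" where
  "laurent N M = {f. \<forall>m\<in>Poly_Mapping.keys f.
     Poly_Mapping.keys m \<subseteq> {..<M} \<and> Poly_Mapping.lookup f m \<in> xpolys N}"

definition xpoly_eval :: "xpoly \<Rightarrow> (nat \<Rightarrow> real) \<Rightarrow> complex" where
  "xpoly_eval p x = (\<Sum>a\<in>Poly_Mapping.keys p.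
     Poly_Mapping.lookup p a *
     (\<Prod>i\<in>Poly_Mapping.keys a. of_real (x i) ^ Poly_Mapping.lookup a i))"

definition laurent_eval :: "laurent_poly \<Rightarrow> (nat \<Rightarrow> real) \<Rightarrow> (nat \<Rightarrow> complex) \<Rightarrow> complex" where
  "laurent_eval f x z = (\<Sum>m\<in>Poly_Mapping.keys f.
     xpoly_eval (Poly_Mapping.lookup f m) x *
     (\<Prod>j\<in>Poly_Mapping.keys m. z j powi Poly_Mapping.lookup m j))"

definition Sp :: "laurent_poly \<Rightarrow> (nat \<Rightarrow>\<^sub>0 int) set" where
  "Sp f = {m. Poly_Mapping.lookup f m \<noteq> 0}"

text \<open>
  For \<open>f \<in> laurent N M\<close>, \<open>Sp f\<close> lies in the copy of \<open>\<int>\<^sup>M\<close> consisting of the vectors supported in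
  \<open>{..<M}\<close>.  Likewise \<open>\<real>\<^sup>M\<close> is a linear subspace of \<open>nat \<Rightarrow>\<^sub>0 real\<close>, so that convex hulls of
  subsets of \<open>\<real>\<^sup>M\<close> can be taken in the larger space.
\<close>

definition real_vec :: "(nat \<Rightarrow>\<^sub>0 int) \<Rightarrow> (nat \<Rightarrow>\<^sub>0 real)" where
  "real_vec m = Poly_Mapping.map real_of_int m"

text \<open>
  Iterated contour integral over the first \<open>M\<close> variables.  A function of these variables is
  represented as one on \<open>nat \<Rightarrow> complex\<close>; the values at indices \<open>\<ge> M\<close> are irrelevant and set to
  \<^term>\<open>undefined\<close>, as for the elements of \<open>PiE {..<M} A\<close>.
\<close>

primrec torus_integral :: "nat \<Rightarrow> ((nat \<Rightarrow> complex) \<Rightarrow> complex) \<Rightarrow> complex" where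
  "torus_integral 0 F = F (\<lambda>_. undefined)"
| "torus_integral (Suc M) F =
     contour_integral (circlepath 0 1) (\<lambda>w. torus_integral M (\<lambda>z. F (z(M := w))) / w)"

definition NM_integral :: "nat \<Rightarrow> nat \<Rightarrow> laurent_poly \<Rightarrow> xpoly \<Rightarrow> complex" where
  "NM_integral N M h \<delta> =
     set_lebesgue_integral (\<Pi>\<^sub>M i\<in>{..<N}. lborel) (\<Pi>\<^sub>E i\<in>{..<N}. {0..1})
       (\<lambda>x. torus_integral M (\<lambda>z. laurent_eval h x z * xpoly_eval \<delta> x))"

end

theory Submission
  imports Defs
begin

text \<open>
  Integrating a Laurent polynomial over the torus extracts its constant coefficient, up to the
  factor \<open>(2 \<pi> \<i>)\<^sup>M\<close> (\<open>torus_integral_laurent_sum\<close>).  So the torus integral of \<open>f\<^sup>n g \<delta>\<close> vanishes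
  for every \<open>x\<close> as soon as \<open>0\<close> is not an exponent of \<open>f\<^sup>n g\<close>, and then the integral over the cube
  vanishes too.

  Suppose that \<open>0\<close> is an exponent of \<open>f\<^sup>n g\<close>.  Then \<open>-k\<close> is an exponent of \<open>f\<^sup>n\<close> for some
  exponent \<open>k\<close> of \<open>g\<close>, and as an exponent of \<open>f\<^sup>n\<close> is a sum of \<open>n\<close> exponents of \<open>f\<close>, the point
  \<open>-k/n\<close> lies in the convex hull of the spectrum of \<open>f\<close> (\<open>keys_power_average\<close>).  The hull is
  closed and misses \<open>0\<close>, while \<open>k\<close> ranges over a finite set, so this is impossible for large \<open>n\<close>
  (\<open>eventually_0_notin_keys_power_mult\<close>).
\<close>

text \<open>
  The integrand has the primitive \<open>w\<^sup>k / k\<close> away from \<open>0\<close>, except for \<open>k = 0\<close>.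
\<close>

lemma has_contour_integral_unit_circle_powi:
  "((\<lambda>w. w powi k / w) has_contour_integral (if k = 0 then 2 * of_real pi * \<i> else 0))
     (circlepath 0 1)"
proof (cases "k = 0")
  case True
  have "(\<lambda>w. 1 / (w - 0 :: complex)) contour_integrable_on circlepath 0 1"
    by (rule contour_integrable_continuous_circlepath) (auto intro!: continuous_intros)
  then have "((\<lambda>w. 1 / (w - 0)) has_contour_integral 2 * of_real pi * \<i>) (circlepath 0 1)"
    using contour_integral_circlepath [of 1 0] has_contour_integral_integral
    by (metis zero_less_one)
  then show ?thesis
    using True by simp
next
  case False
  have deriv: "((\<lambda>w. w powi k / of_int k) has_field_derivative w powi (k - 1)) (at w within - {0})"
    if "w \<in> - {0}" for w :: complex
    using that False by (auto intro!: derivative_eq_intros)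
  have "((\<lambda>w :: complex. w powi (k - 1)) has_contour_integral 0) (circlepath 0 1)"
    using contour_integral_primitive [OF deriv, of "circlepath 0 1"] by auto
  then have "((\<lambda>w. w powi k / w) has_contour_integral 0) (circlepath 0 1)"
    by (rule has_contour_integral_eq) (subst power_int_diff, auto)
  then show ?thesis
    using False by simp
qed

text \<open>
  The sum and its coefficients stay general because integrating out the last variable turns the
  powers of that variable into coefficients of the remaining Laurent polynomial.
\<close>

lemma torus_integral_laurent_sum:
  fixes c :: "'a \<Rightarrow> complex" and p :: "'a \<Rightarrow> nat \<Rightarrow> int"
  assumes "finite A"
  shows "torus_integral M (\<lambda>z. \<Sum>a\<in>A. c a * (\<Prod>j<M. z j powi p a j)) =
    (\<Sum>a\<in>A. if \<forall>j<M. p a j = 0 then c a * (2 * of_real pi * \<i>) ^ M else 0)"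
proof (induction M arbitrary: c)
  case 0
  then show ?case by simp
next
  case (Suc M)
  define X where "X a = (if \<forall>j<M. p a j = 0 then c a * (2 * of_real pi * \<i>) ^ M else 0)" for a
  have inner: "torus_integral M (\<lambda>z. \<Sum>a\<in>A. c a * (\<Prod>j<Suc M. (z(M := w)) j powi p a j)) / w =
      (\<Sum>a\<in>A. X a * (w powi p a M / w))" for w
  proof -
    have "(\<lambda>z. \<Sum>a\<in>A. c a * (\<Prod>j<Suc M. (z(M := w)) j powi p a j)) =
        (\<lambda>z. \<Sum>a\<in>A. (c a * w powi p a M) * (\<Prod>j<M. z j powi p a j))"
      by (simp add: mult_ac)
    then show ?thesis
      unfolding sum_divide_distrib
      by (simp only: Suc.IH) (auto simp: X_def sum_divide_distrib intro!: sum.cong)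
  qed
  have "((\<lambda>w. \<Sum>a\<in>A. X a * (w powi p a M / w)) has_contour_integral
      (\<Sum>a\<in>A. X a * (if p a M = 0 then 2 * of_real pi * \<i> else 0))) (circlepath 0 1)"
    by (intro has_contour_integral_sum has_contour_integral_lmul
        has_contour_integral_unit_circle_powi assms)
  then have "torus_integral (Suc M) (\<lambda>z. \<Sum>a\<in>A. c a * (\<Prod>j<Suc M. z j powi p a j)) =
      (\<Sum>a\<in>A. X a * (if p a M = 0 then 2 * of_real pi * \<i> else 0))"
    unfolding torus_integral.simps inner by (rule contour_integral_unique)
  also have "\<dots> = (\<Sum>a\<in>A. if \<forall>j<Suc M. p a j = 0 then c a * (2 * of_real pi * \<i>) ^ Suc M else 0)"
    by (intro sum.cong) (auto simp: X_def less_Suc_eq)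
  finally show ?case .
qed

lemma NM_integral_eq_0:
  assumes keys: "\<And>m. m \<in> Poly_Mapping.keys h \<Longrightarrow> Poly_Mapping.keys m \<subseteq> {..<M}"
    and zero: "0 \<notin> Poly_Mapping.keys h"
  shows "NM_integral N M h \<delta> = 0"
proof -
  have "torus_integral M (\<lambda>z. laurent_eval h x z * xpoly_eval \<delta> x) = 0" for x
  proof -
    let ?c = "\<lambda>m. xpoly_eval (Poly_Mapping.lookup h m) x * xpoly_eval \<delta> x"
    have "(\<Prod>j\<in>Poly_Mapping.keys m. z j powi Poly_Mapping.lookup m j) =
        (\<Prod>j<M. z j powi Poly_Mapping.lookup m j)"
      if "m \<in> Poly_Mapping.keys h" for m and z :: "nat \<Rightarrow> complex"
      using keys [OF that] by (intro prod.mono_neutral_left) (auto simp: in_keys_iff)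
    then have "(\<lambda>z. laurent_eval h x z * xpoly_eval \<delta> x) =
        (\<lambda>z. \<Sum>m\<in>Poly_Mapping.keys h. ?c m * (\<Prod>j<M. z j powi Poly_Mapping.lookup m j))"
      by (simp add: laurent_eval_def sum_distrib_right sum_distrib_left mult_ac)
    then have "torus_integral M (\<lambda>z. laurent_eval h x z * xpoly_eval \<delta> x) =
        (\<Sum>m\<in>Poly_Mapping.keys h. if \<forall>j<M. Poly_Mapping.lookup m j = 0
          then ?c m * (2 * of_real pi * \<i>) ^ M else 0)"
      by (simp add: torus_integral_laurent_sum)
    moreover have "\<not> (\<forall>j<M. Poly_Mapping.lookup m j = 0)" if "m \<in> Poly_Mapping.keys h" for m
    proof
      assume "\<forall>j<M. Poly_Mapping.lookup m j = 0"
      then have "m = 0"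
        using keys [OF that] by (metis in_keys_iff lessThan_iff lookup_zero poly_mapping_eqI subsetD)
      then show False
        using zero that by simp
    qed
    ultimately show ?thesis
      by (simp only: if_False sum.neutral_const cong: sum.cong)
  qed
  then show ?thesis
    by (simp add: NM_integral_def set_lebesgue_integral_def)
qed

lemma keys_subset_laurent_mult:
  fixes f g :: "('a \<Rightarrow>\<^sub>0 int) \<Rightarrow>\<^sub>0 'b::semiring_0"
  assumes "\<And>m. m \<in> Poly_Mapping.keys f \<Longrightarrow> Poly_Mapping.keys m \<subseteq> V"
    and "\<And>m. m \<in> Poly_Mapping.keys g \<Longrightarrow> Poly_Mapping.keys m \<subseteq> V"
    and "m \<in> Poly_Mapping.keys (f * g)"
  shows "Poly_Mapping.keys m \<subseteq> V"
proof -
  obtain a b where "m = a + b" "a \<in> Poly_Mapping.keys f" "b \<in> Poly_Mapping.keys g"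
    using keys_mult assms(3) by blast
  then show ?thesis
    using assms(1,2) keys_add [of a b] by blast
qed

lemma keys_subset_laurent_power:
  fixes f :: "('a \<Rightarrow>\<^sub>0 int) \<Rightarrow>\<^sub>0 'b::semiring_1"
  assumes "\<And>m. m \<in> Poly_Mapping.keys f \<Longrightarrow> Poly_Mapping.keys m \<subseteq> V"
    and "m \<in> Poly_Mapping.keys (f ^ n)"
  shows "Poly_Mapping.keys m \<subseteq> V"
  using assms(2)
proof (induction n arbitrary: m)
  case 0
  then show ?case by (simp split: if_splits)
next
  case (Suc n)
  then show ?case
    using keys_subset_laurent_mult [of f V "f ^ n" m] assms(1) by (metis power_Suc)
qed

lemma lookup_real_vec [simp]:
  "Poly_Mapping.lookup (real_vec m) i = of_int (Poly_Mapping.lookup m i)"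
  by (simp add: real_vec_def Poly_Mapping.map.rep_eq when_def)

lemma real_vec_0 [simp]: "real_vec 0 = 0"
  by (rule poly_mapping_eqI) simp

lemma real_vec_add: "real_vec (a + b) = real_vec a + real_vec b"
  by (rule poly_mapping_eqI) (simp add: lookup_add)

lemma Sp_eq_keys: "Sp f = Poly_Mapping.keys f"
  by (auto simp: Sp_def in_keys_iff)

text \<open>
  The average of \<open>n + 1\<close> exponents is a convex combination of one of them, with weight
  \<open>1 / (n + 1)\<close>, and the average of the other \<open>n\<close>.
\<close>

lemma keys_power_average:
  fixes f :: laurent_poly
  assumes "m \<in> Poly_Mapping.keys (f ^ n)" and "n \<ge> 1"
  shows "(1 / real n) *\<^sub>R real_vec m \<in> convex hull (real_vec ` Sp f)"
  using assms(2,1)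
proof (induction n arbitrary: m rule: nat_induct_at_least)
  case base
  then show ?case by (simp add: Sp_eq_keys hull_inc)
next
  case (Suc n)
  obtain a b where m: "m = a + b" and a: "a \<in> Poly_Mapping.keys f"
      and b: "b \<in> Poly_Mapping.keys (f ^ n)"
    using keys_mult [of f "f ^ n"] Suc.prems by auto
  have "(1 / real (Suc n)) *\<^sub>R real_vec a + (real n / real (Suc n)) *\<^sub>R ((1 / real n) *\<^sub>R real_vec b)
      \<in> convex hull (real_vec ` Sp f)"
  proof (rule convexD [OF convex_convex_hull])
    show "real_vec a \<in> convex hull (real_vec ` Sp f)"
      using a by (simp add: Sp_eq_keys hull_inc)
  qed (use Suc.IH [OF b] Suc.hyps in \<open>auto simp: field_simps\<close>)
  also have "(1 / real (Suc n)) *\<^sub>R real_vec a + (real n / real (Suc n)) *\<^sub>R ((1 / real n) *\<^sub>R real_vec b)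
      = (1 / real (Suc n)) *\<^sub>R real_vec m"
    using Suc.hyps by (simp add: m real_vec_add scaleR_add_right)
  finally show ?case .
qed

text \<open>
  For each of the finitely many exponents \<open>k\<close> of \<open>g\<close>, the points \<open>-k/n\<close> tend to \<open>0\<close>, so they
  end up in the complement of the hull, which is open because the hull of a finite set is compact.
\<close>

lemma eventually_0_notin_keys_power_mult:
  fixes f g :: laurent_poly
  assumes "0 \<notin> convex hull (real_vec ` Sp f)"
  shows "\<forall>\<^sub>F n in sequentially. 0 \<notin> Poly_Mapping.keys (f ^ n * g)"
proof -
  let ?K = "convex hull (real_vec ` Sp f)"
  have "open (- ?K)"
    by (intro open_Compl compact_imp_closed finite_imp_compact_convex_hull)
      (simp add: Sp_eq_keys)
  have "\<forall>\<^sub>F n in sequentially. (1 / real n) *\<^sub>R (- real_vec k) \<in> - ?K" for k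
  proof (rule topological_tendstoD [OF _ \<open>open (- ?K)\<close>])
    show "(\<lambda>n. (1 / real n) *\<^sub>R (- real_vec k)) \<longlonglongrightarrow> 0"
      using tendsto_scaleR [OF lim_1_over_n tendsto_const [of "- real_vec k"]] by simp
  qed (use assms in simp)
  then have "\<forall>\<^sub>F n in sequentially.
      \<forall>k\<in>Poly_Mapping.keys g. (1 / real n) *\<^sub>R (- real_vec k) \<in> - ?K"
    by (simp add: eventually_ball_finite)
  then show ?thesis
    using eventually_ge_at_top [of 1]
  proof eventually_elim
    case (elim n)
    show ?case
    proof
      assume "0 \<in> Poly_Mapping.keys (f ^ n * g)"
      then obtain m k where mk: "0 = m + k" and m: "m \<in> Poly_Mapping.keys (f ^ n)"
          and k: "k \<in> Poly_Mapping.keys g"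
        using keys_mult [of "f ^ n" g] by blast
      have "real_vec m = - real_vec k"
        using real_vec_add [of m k] mk by (simp add: eq_neg_iff_add_eq_0)
      then show False
        using keys_power_average [OF m] elim k by auto
    qed
  qed
qed

theorem proposition6p5:
  fixes N M :: nat and f g :: laurent_poly and \<delta> :: xpoly
    and e :: "nat \<Rightarrow>\<^sub>0 nat" and c :: complex
  assumes "f \<in> laurent N M" and "g \<in> laurent N M" and "\<delta> \<in> xpolys N"
    and "\<delta> = Poly_Mapping.single e c" and "c \<noteq> 0"
    and "\<forall>i<N. odd (Poly_Mapping.lookup e i)"
    and "0 \<notin> convex hull (real_vec ` Sp f)"
  shows "finite {n::nat. n \<ge> 1 \<and> NM_integral N M (f ^ n * g) \<delta> \<noteq> 0}"
proof -
  have f: "Poly_Mapping.keys m \<subseteq> {..<M}" if "m \<in> Poly_Mapping.keys f" for m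
    using assms(1) that by (auto simp: laurent_def)
  have g: "Poly_Mapping.keys m \<subseteq> {..<M}" if "m \<in> Poly_Mapping.keys g" for m
    using assms(2) that by (auto simp: laurent_def)
  have "Poly_Mapping.keys m \<subseteq> {..<M}" if "m \<in> Poly_Mapping.keys (f ^ n * g)" for m n
    using keys_subset_laurent_mult [OF keys_subset_laurent_power [OF f] g that] .
  then have "\<forall>\<^sub>F n in sequentially. NM_integral N M (f ^ n * g) \<delta> = 0"
    using eventually_0_notin_keys_power_mult [OF assms(7), of g]
    by (auto elim!: eventually_mono intro!: NM_integral_eq_0)
  then have "finite {n. NM_integral N M (f ^ n * g) \<delta> \<noteq> 0}"
    by (simp add: cofinite_eq_sequentially [symmetric] eventually_cofinite)
  then show ?thesis
    by (rule rev_finite_subset) auto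
qed

end
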